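(* Let $\mathbf P_1,\mathbf P_2$ be known symmetric $d\times d$ edge probability matrices, and let a network $\mathbf X$ be sampled from $\mathbf P_1$, i.e. $\mathbf X(\omega)\sim\mathrm{Bern}(\mathbf P_1(\omega))$ independently for $\omega\in\mathcal J_d$. Then the probability of mis-clustering $\mathbf X$ by the likelihood-based Lloyd's algorithm satisfies $$\mathbb P(\mathbf X\text{ is mis-clustered})\le\exp(-I^{*}/2),$$ where $$I^{*}=-2\sum_{\omega\in\mathcal J_d}\log\Big(\sqrt{\mathbf P_1(\omega)\mathbf P_2(\omega)}+\sqrt{(1-\mathbf P_1(\omega))(1-\mathbf P_2(\omega))}\Big).$$ Similarly, the same bound holds if $\mathbf X$ is sampled from $\mathbf P_2$.
   Context: $\mathcal J_d=\{(j_1,j_2):1\le j_1\le j_2\le d\}$. The log-likelihood is $\ell(\mathbf X|z)=\sum_{\omega\in\mathcal J_d}\mathbf X(\omega)\log\mathbf P_z(\omega)+\sum_{\omega\in\mathcal J_d}(1-\mathbf X(\omega))\log(1-\mathbf P_z(\omega))$, $z\in\{1,2\}$; edge probabilities lie in $(0,1)$. The (oracle) likelihood-based Lloyd's algorithm assigns to $\mathbf X$ the label maximizing $\ell(\mathbf X|z)$. When the true label is $1$, $\mathbf X$ is mis-clustered if $$\sum_{\omega\in\mathcal J_d}\mathbf X(\omega)\log\frac{\mathbf P_2(\omega)(1-\mathbf P_1(\omega))}{\mathbf P_1(\omega)(1-\mathbf P_2(\omega))}>\sum_{\omega\in\mathcal J_d}\log\frac{1-\mathbf P_1(\omega)}{1-\mathbf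 P_2(\omega)},$$ i.e. $\ell(\mathbf X|2)>\ell(\mathbf X|1)$; when the true label is $2$ the roles of $1,2$ are swapped. *)

theory Defs
  imports "HOL-Probability.Probability"
begin

type_synonym prob_matrix = "nat \<times> nat \<Rightarrow> real"
type_synonym network = "nat \<times> nat \<Rightarrow> bool"

text \<open>
  A \<open>d \<times> d\<close> matrix is a function on index pairs, of which only the values at indices in
  \<open>{1..d} \<times> {1..d}\<close> matter. An undirected network (self-loops allowed) is given by its edge
  indicators on the upper triangle, diagonal included.
\<close>

definition upper_pairs :: "nat \<Rightarrow> (nat \<times> nat) set" where
  "upper_pairs d = {(i, j). 1 \<le> i \<and> i \<le> j \<and> j \<le> d}"

definition edge_prob_matrix :: "nat \<Rightarrow> prob_matrix \<Rightarrow> bool" where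
  "edge_prob_matrix d P \<longleftrightarrow>
     (\<forall>i\<in>{1..d}. \<forall>j\<in>{1..d}. P (i, j) = P (j, i) \<and> 0 < P (i, j) \<and> P (i, j) < 1)"

definition network_sampled_from ::
  "'a measure \<Rightarrow> nat \<Rightarrow> ('a \<Rightarrow> network) \<Rightarrow> prob_matrix \<Rightarrow> bool" where
  "network_sampled_from M d X P \<longleftrightarrow>
     prob_space.indep_vars M (\<lambda>_. count_space UNIV) (\<lambda>e \<omega>. X \<omega> e) (upper_pairs d) \<and>
     (\<forall>e\<in>upper_pairs d.
        distr M (count_space UNIV) (\<lambda>\<omega>. X \<omega> e) = measure_pmf (bernoulli_pmf (P e)))"

definition log_lik :: "nat \<Rightarrow> prob_matrix \<Rightarrow> network \<Rightarrow> real" where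
  "log_lik d P x =
     (\<Sum>e\<in>upper_pairs d. of_bool (x e) * ln (P e)) +
     (\<Sum>e\<in>upper_pairs d. (1 - of_bool (x e)) * ln (1 - P e))"

text \<open>
  In \<open>misclustered d P Q x\<close>, the matrix \<open>P\<close> belongs to the true label and \<open>Q\<close> to the other one.
  Likelihood-based clustering picks the label of larger log-likelihood; a tie does not count
  as an error.
\<close>

definition misclustered :: "nat \<Rightarrow> prob_matrix \<Rightarrow> prob_matrix \<Rightarrow> network \<Rightarrow> bool" where
  "misclustered d P Q x \<longleftrightarrow> log_lik d Q x > log_lik d P x"

definition I_star :: "nat \<Rightarrow> prob_matrix \<Rightarrow> prob_matrix \<Rightarrow> real" where
  "I_star d P Q =
     - 2 * (\<Sum>e\<in>upper_pairs d. ln (sqrt (P e * Q e) + sqrt ((1 - P e) * (1 - Q e))))"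

text \<open>The error event in log-odds form.\<close>

lemma misclustered_iff:
  assumes "edge_prob_matrix d P" "edge_prob_matrix d Q"
  shows "misclustered d P Q x \<longleftrightarrow>
    (\<Sum>e\<in>upper_pairs d. of_bool (x e) * ln (Q e * (1 - P e) / (P e * (1 - Q e))))
      > (\<Sum>e\<in>upper_pairs d. ln ((1 - P e) / (1 - Q e)))"
proof -
  have pos: "0 < P e \<and> P e < 1 \<and> 0 < Q e \<and> Q e < 1" if "e \<in> upper_pairs d" for e
    using that assms by (cases e) (auto simp: upper_pairs_def edge_prob_matrix_def)
  have "log_lik d Q x - log_lik d P x =
    (\<Sum>e\<in>upper_pairs d. of_bool (x e) * ln (Q e) + (1 - of_bool (x e)) * ln (1 - Q e)
       - (of_bool (x e) * ln (P e) + (1 - of_bool (x e)) * ln (1 - P e)))"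
    by (simp add: log_lik_def sum.distrib sum_subtractf)
  also have "\<dots> = (\<Sum>e\<in>upper_pairs d.
      of_bool (x e) * ln (Q e * (1 - P e) / (P e * (1 - Q e))) - ln ((1 - P e) / (1 - Q e)))"
    by (rule sum.cong[OF refl]) (frule pos, simp add: ln_div ln_mult)
  also have "\<dots> = (\<Sum>e\<in>upper_pairs d. of_bool (x e) * ln (Q e * (1 - P e) / (P e * (1 - Q e))))
      - (\<Sum>e\<in>upper_pairs d. ln ((1 - P e) / (1 - Q e)))"
    by (simp add: sum_subtractf)
  finally show ?thesis
    by (auto simp: misclustered_def)
qed

end

theory Submission
  imports Defs
begin

text \<open>
  Chernoff's method with exponent \<open>1/2\<close>: an error means that the square root of the likelihood
  ratio exceeds \<open>1\<close>, and by independence the expectation of this square root is the product of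
  the Bhattacharyya coefficients of the individual edges.
\<close>

definition sqrt_ratio :: "real \<Rightarrow> real \<Rightarrow> bool \<Rightarrow> real" where
  "sqrt_ratio p q b = (if b then sqrt (q / p) else sqrt ((1 - q) / (1 - p)))"

lemma finite_upper_pairs: "finite (upper_pairs d)"
  by (rule finite_subset[of _ "{1..d} \<times> {1..d}"]) (auto simp: upper_pairs_def)

lemma edge_prob_matrix_bounds:
  assumes "edge_prob_matrix d P" "e \<in> upper_pairs d"
  shows "0 < P e" "P e < 1"
  using assms by (cases e; auto simp: upper_pairs_def edge_prob_matrix_def)+

lemma sqrt_ratio_nonneg:
  assumes "0 < p" "p < 1" "0 < q" "q < 1"
  shows "0 \<le> sqrt_ratio p q b"
  using assms by (simp add: sqrt_ratio_def)

text \<open>For either value of \<open>b\<close> one of the indicator weights vanishes, so the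
  exponent is half of a single log ratio. In this form the factors of different edges multiply by
  adding their log-likelihood gaps.\<close>

lemma sqrt_ratio_eq_exp:
  assumes "0 < p" "p < 1" "0 < q" "q < 1"
  shows "sqrt_ratio p q b =
    exp ((of_bool b * ln q + (1 - of_bool b) * ln (1 - q)
        - (of_bool b * ln p + (1 - of_bool b) * ln (1 - p))) / 2)"
proof -
  have "sqrt (u / v) = exp ((ln u - ln v) / 2)" if "0 < u" "0 < v" for u v :: real
    using that by (simp add: powr_half_sqrt[symmetric] powr_def ln_div)
  with assms show ?thesis
    by (simp add: sqrt_ratio_def)
qed

lemma prod_sqrt_ratio_eq_exp:
  assumes "edge_prob_matrix d P" "edge_prob_matrix d Q"
  shows "(\<Prod>e\<in>upper_pairs d. sqrt_ratio (P e) (Q e) (x e)) = exp ((log_lik d Q x - log_lik d P x) / 2)"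
proof -
  have "(\<Prod>e\<in>upper_pairs d. sqrt_ratio (P e) (Q e) (x e)) =
    exp (\<Sum>e\<in>upper_pairs d. (of_bool (x e) * ln (Q e) + (1 - of_bool (x e)) * ln (1 - Q e)
        - (of_bool (x e) * ln (P e) + (1 - of_bool (x e)) * ln (1 - P e))) / 2)"
    unfolding exp_sum[OF finite_upper_pairs]
    by (intro prod.cong refl sqrt_ratio_eq_exp edge_prob_matrix_bounds[OF assms(1)]
        edge_prob_matrix_bounds[OF assms(2)])
  then show ?thesis
    unfolding log_lik_def sum_divide_distrib[symmetric] sum_subtractf sum.distrib .
qed

text \<open>An outcome of probability \<open>u\<close> under the sampling law and \<open>v\<close>
  under the other contributes \<open>sqrt (v / u) * u = sqrt (u * v)\<close>. Summing over both
  outcomes gives the Bhattacharyya coefficient of the two Bernoulli laws.\<close>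

lemma integral_sqrt_ratio_bernoulli:
  assumes "0 < p" "p < 1" "0 < q" "q < 1"
  shows "measure_pmf.expectation (bernoulli_pmf p) (sqrt_ratio p q)
    = sqrt (p * q) + sqrt ((1 - p) * (1 - q))"
proof -
  have "sqrt (v / u) * u = sqrt (u * v)" if "0 < u" for u v :: real
    using that by (simp add: real_sqrt_divide real_sqrt_mult real_div_sqrt field_simps)
  with assms show ?thesis
    by (simp add: sqrt_ratio_def)
qed

text \<open>The factors \<open>- 2\<close> and \<open>- 1 / 2\<close> cancel, leaving
  \<open>exp\<close> of a sum of logarithms; \<open>exp\<close> undoes each \<open>ln\<close>
  because the coefficients are positive.\<close>

lemma exp_I_star:
  assumes "edge_prob_matrix d P" "edge_prob_matrix d Q"
  shows "exp (- I_star d P Q / 2)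
    = (\<Prod>e\<in>upper_pairs d. sqrt (P e * Q e) + sqrt ((1 - P e) * (1 - Q e)))"
proof -
  have "0 < sqrt (P e * Q e) + sqrt ((1 - P e) * (1 - Q e))" if "e \<in> upper_pairs d" for e
    using edge_prob_matrix_bounds[OF assms(1) that] edge_prob_matrix_bounds[OF assms(2) that]
    by (intro add_pos_pos) auto
  then show ?thesis
    by (simp add: I_star_def exp_sum[OF finite_upper_pairs])
qed

text \<open>Bhattacharyya coefficients are symmetric in the two laws, so one exponent serves both
  choices of the true label.\<close>

lemma I_star_commute: "I_star d P Q = I_star d Q P"
  by (simp add: I_star_def mult.commute)

lemma misclustered_prob_le:
  fixes M :: "'a measure" and X :: "'a \<Rightarrow> network"
  assumes M: "prob_space M"
    and P: "edge_prob_matrix d P" and Q: "edge_prob_matrix d Q"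
    and X: "network_sampled_from M d X P"
  shows "measure M {\<omega> \<in> space M. misclustered d P Q (X \<omega>)} \<le> exp (- I_star d P Q / 2)"
proof -
  interpret prob_space M by (rule M)
  note bounds = edge_prob_matrix_bounds[OF P] edge_prob_matrix_bounds[OF Q]
  define Y where "Y e \<omega> = sqrt_ratio (P e) (Q e) (X \<omega> e)" for e \<omega>
  define Z where "Z \<omega> = (\<Prod>e\<in>upper_pairs d. Y e \<omega>)" for \<omega>
  have indep_X: "indep_vars (\<lambda>_. count_space UNIV) (\<lambda>e \<omega>. X \<omega> e) (upper_pairs d)"
    and distr_X: "\<And>e. e \<in> upper_pairs d \<Longrightarrow>
      distr M (count_space UNIV) (\<lambda>\<omega>. X \<omega> e) = measure_pmf (bernoulli_pmf (P e))"
    using X by (auto simp: network_sampled_from_def)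
  have meas_X: "(\<lambda>\<omega>. X \<omega> e) \<in> measurable M (count_space UNIV)" if "e \<in> upper_pairs d" for e
    using indep_X that by (auto simp: indep_vars_def)
  \<comment> \<open>Each \<open>Y e\<close> is a function of one edge indicator, and every function
    on a discrete space is measurable, so independence carries over.\<close>
  have indep_Y: "indep_vars (\<lambda>_. borel) Y (upper_pairs d)"
    unfolding Y_def by (rule indep_vars_compose2[OF indep_X]) simp
  have int_Y: "integrable M (Y e)"
    and exp_Y: "expectation (Y e) = sqrt (P e * Q e) + sqrt ((1 - P e) * (1 - Q e))"
    if e: "e \<in> upper_pairs d" for e
  proof -
    have "integrable (bernoulli_pmf (P e)) (sqrt_ratio (P e) (Q e))"
      by (rule integrable_measure_pmf_finite) simp
    then show "integrable M (Y e)"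
      unfolding Y_def distr_X[OF e, symmetric]
      by (subst (asm) integrable_distr_eq[OF meas_X[OF e]]) auto
    have "expectation (Y e) = measure_pmf.expectation (bernoulli_pmf (P e)) (sqrt_ratio (P e) (Q e))"
      unfolding Y_def distr_X[OF e, symmetric] by (subst integral_distr[OF meas_X[OF e]]) auto
    then show "expectation (Y e) = sqrt (P e * Q e) + sqrt ((1 - P e) * (1 - Q e))"
      by (simp only: integral_sqrt_ratio_bernoulli bounds e)
  qed
  have int_Z: "integrable M Z"
    unfolding Z_def by (rule indep_vars_integrable[OF finite_upper_pairs indep_Y int_Y])
  have Z_nonneg: "0 \<le> Z \<omega>" for \<omega>
    unfolding Z_def Y_def by (intro prod_nonneg sqrt_ratio_nonneg ballI bounds)
  \<comment> \<open>\<open>Z\<close> is the exponential of half the log-likelihood gap, so an error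
    forces \<open>Z > 1\<close>. The weak inequality also admits ties, which is harmless for an
    upper bound and is the form of event in Markov's inequality.\<close>
  have "{\<omega> \<in> space M. misclustered d P Q (X \<omega>)} \<subseteq> {\<omega> \<in> space M. 1 \<le> Z \<omega>}"
    by (auto simp: misclustered_def Z_def Y_def prod_sqrt_ratio_eq_exp[OF P Q])
  then have "prob {\<omega> \<in> space M. misclustered d P Q (X \<omega>)} \<le> prob {\<omega> \<in> space M. 1 \<le> Z \<omega>}"
    using int_Z by (intro finite_measure_mono) auto
  \<comment> \<open>Markov's inequality at threshold 1, applicable since \<open>Z\<close> is
    nonnegative.\<close>
  also have "\<dots> \<le> expectation Z"
    using integral_Markov_inequality_measure[OF int_Z sets.empty_sets, of 1] Z_nonneg by simp
  also have "\<dots> = (\<Prod>e\<in>upper_pairs d. expectation (Y e))"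
    unfolding Z_def by (rule indep_vars_lebesgue_integral[OF finite_upper_pairs indep_Y int_Y])
  also have "\<dots> = exp (- I_star d P Q / 2)"
    unfolding exp_I_star[OF P Q] by (simp add: exp_Y)
  finally show ?thesis .
qed

theorem lemma1:
  fixes d :: nat and P1 P2 :: prob_matrix
    and M :: "'a measure" and X :: "'a \<Rightarrow> network"
  assumes "prob_space M"
    and "edge_prob_matrix d P1"
    and "edge_prob_matrix d P2"
  shows "(network_sampled_from M d X P1 \<longrightarrow>
            measure M {\<omega> \<in> space M. misclustered d P1 P2 (X \<omega>)} \<le> exp (- I_star d P1 P2 / 2))
       \<and> (network_sampled_from M d X P2 \<longrightarrow>
            measure M {\<omega> \<in> space M. misclustered d P2 P1 (X \<omega>)} \<le> exp (- I_star d P1 P2 / 2))"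
  \<comment> \<open>The second instance exchanges the two matrices, which makes \<open>P2\<close>
    the sampling law.\<close>
  using misclustered_prob_le[OF assms] misclustered_prob_le[OF assms(1,3,2)]
  by (simp add: I_star_commute[of d P2 P1])

end
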